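(* For $j=0,1,2$ let $a_j,b_j:\mathbb{Z}\to\mathbb{R}$ with $a_j(n)<0$ for all $n\in\mathbb{Z}$, and let $J_j$ be the associated $(N-1)\times(N-1)$ Jacobi matrix. Let $\lambda\in\mathbb{R}$ and let $u_{j,-}(\lambda)$, $u_{j,+}(\lambda)$ be solutions of $\tau_ju=\lambda u$ with $u_{j,-}(\lambda)(0)=0$ and $u_{j,+}(\lambda)(N)=0$. If $J_1\ge J_2$ (i.e. $J_1-J_2$ is positive semidefinite), then $$\#_{[0,N]}(u_{0,+}(\lambda),u_{2,-}(\lambda))\ge\#_{[0,N]}(u_{0,+}(\lambda),u_{1,-}(\lambda))\quad\text{and}\quad \#_{[0,N]}(u_{0,-}(\lambda),u_{2,+}(\lambda))\ge\#_{[0,N]}(u_{0,-}(\lambda),u_{1,+}(\lambda)),$$ and both inequalities also hold with $\#_{[0,N]}$ replaced (on both sides) by $\#_{(0,N]}$, by $\#_{[0,N)}$, or by $\#_{(0,N)}$.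
   Context: Let $N\ge 2$ be an integer. For $a,b:\mathbb{Z}\to\mathbb{R}$ with $a<0$, the Jacobi matrix $J$ is the real symmetric tridiagonal $(N-1)\times(N-1)$ matrix with diagonal entries $b(1),\dots,b(N-1)$ and off-diagonal entries $J_{i,i+1}=J_{i+1,i}=a(i)$, $i=1,\dots,N-2$. The difference expression is $(\tau u)(n)=a(n)u(n+1)+a(n-1)u(n-1)+b(n)u(n)$, $n\in\mathbb{Z}$. A solution of $\tau u=zu$ ($z\in\mathbb{R}$) is a real sequence $u:\mathbb{Z}\to\mathbb{R}$, $u\not\equiv 0$, satisfying the equation for all $n\in\mathbb{Z}$. $J_j,\tau_j$ denote the objects built from $a_j,b_j$. For a solution $u_i$ of $\tau_iu=\lambda u$ and a solution $u_j$ of $\tau_ju=\lambda u$, the (modified) Wronskian is $W_n=W_n(u_i,u_j)=u_i(n)a_j(n)u_j(n+1)-u_j(n)a_i(n)u_i(n+1)$. Define - $\#_n(u_i,u_j)=1$ if $W_{n+1}u_i(n+1)u_j(n+1)>0$ and either $W_nW_{n+1}<0$ or ($W_n=0$ and $W_{n+1}\ne0$); - $\#_n(u_i,u_j)=-1$ if $W_nu_i(n+1)u_j(n+1)>0$ and either $W_nW_{n+1}<0$ or ($W_n\neq0$ and $W_{n+1}=0$); - $\#_n(u_i,u_j)=0$ otherwise. For integers $m<n$ set $\#_{[m,n]}(u_i,u_j)=\sum_{k=m}^{n-1}\#_k(u_i,u_j)$. Let $\epsilon_k=1$ if $W_k(u_i,u_j)=0$ and $\epsilon_k=0$ otherwise.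 Then $\#_{(m,n]}=\#_{[m,n]}-\epsilon_m$, $\#_{[m,n)}=\#_{[m,n]}+\epsilon_n$, and $\#_{(m,n)}=\#_{[m,n]}-\epsilon_m+\epsilon_n$ (all evaluated at $(u_i,u_j)$). *)

theory Defs
  imports Complex_Main "Jordan_Normal_Form.Matrix"
begin

definition tau :: "(int \<Rightarrow> real) \<Rightarrow> (int \<Rightarrow> real) \<Rightarrow> (int \<Rightarrow> real) \<Rightarrow> int \<Rightarrow> real" where
  "tau a b u n = a n * u (n + 1) + a (n - 1) * u (n - 1) + b n * u n"

definition is_solution :: "(int \<Rightarrow> real) \<Rightarrow> (int \<Rightarrow> real) \<Rightarrow> real \<Rightarrow> (int \<Rightarrow> real) \<Rightarrow> bool" where
  "is_solution a b z u \<longleftrightarrow> (\<forall>n. tau a b u n = z * u n) \<and> (\<exists>n. u n \<noteq> 0)"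

text \<open>Matrix indices start at 0, so the entry at position \<open>(i, j)\<close> below is the one in
  row \<open>i + 1\<close> and column \<open>j + 1\<close> of the usual 1-based Jacobi matrix.\<close>

definition jacobi_mat :: "nat \<Rightarrow> (int \<Rightarrow> real) \<Rightarrow> (int \<Rightarrow> real) \<Rightarrow> real mat" where
  "jacobi_mat N a b = mat (N - 1) (N - 1) (\<lambda>(i, j).
     if i = j then b (int i + 1)
     else if j = i + 1 then a (int i + 1)
     else if i = j + 1 then a (int j + 1)
     else 0)"

definition positive_semidefinite :: "real mat \<Rightarrow> bool" where
  "positive_semidefinite A \<longleftrightarrow> square_mat A \<and> transpose_mat A = A \<and>
     (\<forall>v \<in> carrier_vec (dim_row A). 0 \<le> v \<bullet> (A *\<^sub>v v))"

text \<open>The modified Wronskian depends on the coefficients \<open>a\<^sub>i\<close>, \<open>a\<^sub>j\<close> as well as on the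
  solutions, so they are explicit arguments here and in the node counts below.\<close>

definition wronskian ::
  "(int \<Rightarrow> real) \<Rightarrow> (int \<Rightarrow> real) \<Rightarrow> (int \<Rightarrow> real) \<Rightarrow> (int \<Rightarrow> real) \<Rightarrow> int \<Rightarrow> real" where
  "wronskian ai aj ui uj n = ui n * aj n * uj (n + 1) - uj n * ai n * ui (n + 1)"

definition node ::
  "(int \<Rightarrow> real) \<Rightarrow> (int \<Rightarrow> real) \<Rightarrow> (int \<Rightarrow> real) \<Rightarrow> (int \<Rightarrow> real) \<Rightarrow> int \<Rightarrow> int" where
  "node ai aj ui uj n = (let W = wronskian ai aj ui uj in
     if W (n + 1) * ui (n + 1) * uj (n + 1) > 0 \<and>
        (W n * W (n + 1) < 0 \<or> (W n = 0 \<and> W (n + 1) \<noteq> 0)) then 1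
     else if W n * ui (n + 1) * uj (n + 1) > 0 \<and>
        (W n * W (n + 1) < 0 \<or> (W n \<noteq> 0 \<and> W (n + 1) = 0)) then - 1
     else 0)"

text \<open>The two nonzero cases exclude each other, so their order above is immaterial.\<close>

lemma node_cases_exclusive:
  fixes W W' p q :: real
  assumes "W' * p * q > 0" "W * W' < 0 \<or> (W = 0 \<and> W' \<noteq> 0)"
  shows "\<not> (W * p * q > 0 \<and> (W * W' < 0 \<or> (W \<noteq> 0 \<and> W' = 0)))"
  using assms by (auto simp: zero_less_mult_iff mult_less_0_iff)

definition eps ::
  "(int \<Rightarrow> real) \<Rightarrow> (int \<Rightarrow> real) \<Rightarrow> (int \<Rightarrow> real) \<Rightarrow> (int \<Rightarrow> real) \<Rightarrow> int \<Rightarrow> int" where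
  "eps ai aj ui uj n = (if wronskian ai aj ui uj n = 0 then 1 else 0)"

text \<open>Weighted node counts on \<open>[m, n]\<close>, \<open>(m, n]\<close>, \<open>[m, n)\<close> and \<open>(m, n)\<close>, for \<open>m < n\<close>.\<close>

definition nodes_cc ::
  "(int \<Rightarrow> real) \<Rightarrow> (int \<Rightarrow> real) \<Rightarrow> (int \<Rightarrow> real) \<Rightarrow> (int \<Rightarrow> real) \<Rightarrow> int \<Rightarrow> int \<Rightarrow> int" where
  "nodes_cc ai aj ui uj m n = (\<Sum>k = m..<n. node ai aj ui uj k)"

definition nodes_oc ::
  "(int \<Rightarrow> real) \<Rightarrow> (int \<Rightarrow> real) \<Rightarrow> (int \<Rightarrow> real) \<Rightarrow> (int \<Rightarrow> real) \<Rightarrow> int \<Rightarrow> int \<Rightarrow> int" where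
  "nodes_oc ai aj ui uj m n = nodes_cc ai aj ui uj m n - eps ai aj ui uj m"

definition nodes_co ::
  "(int \<Rightarrow> real) \<Rightarrow> (int \<Rightarrow> real) \<Rightarrow> (int \<Rightarrow> real) \<Rightarrow> (int \<Rightarrow> real) \<Rightarrow> int \<Rightarrow> int \<Rightarrow> int" where
  "nodes_co ai aj ui uj m n = nodes_cc ai aj ui uj m n + eps ai aj ui uj n"

definition nodes_oo ::
  "(int \<Rightarrow> real) \<Rightarrow> (int \<Rightarrow> real) \<Rightarrow> (int \<Rightarrow> real) \<Rightarrow> (int \<Rightarrow> real) \<Rightarrow> int \<Rightarrow> int \<Rightarrow> int" where
  "nodes_oo ai aj ui uj m n =
     nodes_cc ai aj ui uj m n - eps ai aj ui uj m + eps ai aj ui uj n"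

end

theory Submission
  imports Defs
begin

text \<open>With the Riccati variable \<open>r(k) = -a(k) u(k+1) / u(k)\<close>, read as \<open>-\<infinity>\<close> where \<open>u\<close>
  vanishes, the weighted node at \<open>k\<close> is the crossing of \<open>uj\<close> minus the crossing of \<open>ui\<close>
  plus the increment of the indicator of \<open>rj < ri\<close>. Summing, everything that comes from
  \<open>u\<^sub>0\<close> alone is the same on both sides of each inequality, and it remains to compare the
  crossing counts \<open>n\<^sub>1\<close>, \<open>n\<^sub>2\<close> of solutions for \<open>J\<^sub>1\<close> and \<open>J\<^sub>2\<close> that vanish at the same
  endpoint, with or without a zero at the other endpoint; by reflection, the common zero may be
  taken to be \<open>0\<close>.

  The \<open>r\<^sub>j(k)\<close> are the pivots of Gaussian elimination for \<open>J\<^sub>j - \<lambda>\<close>, satisfying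
  \<open>r(k+1) = b(k+1) - \<lambda> - a(k)\<^sup>2 / r(k)\<close>. Let \<open>d(k) \<ge> 0\<close> be the pivots of the positive
  semidefinite matrix \<open>J\<^sub>1 - J\<^sub>2\<close>. The invariant is that \<open>n\<^sub>1 < n\<^sub>2\<close>, or \<open>n\<^sub>1 = n\<^sub>2\<close> and
  \<open>r\<^sub>1 \<ge> r\<^sub>2 + d\<close>; it is preserved because
  \<open>(s + t)\<^sup>2 / (x + y) \<le> s\<^sup>2 / x + t\<^sup>2 / y\<close> for positive \<open>x\<close>, \<open>y\<close>.\<close>

section \<open>Zeros and sign changes of solutions\<close>

definition crossing :: "(int \<Rightarrow> real) \<Rightarrow> int \<Rightarrow> int" where
  "crossing u k = of_bool (u k = 0 \<or> u k * u (k + 1) < 0)"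

text \<open>A zero at \<open>k\<close> counts at \<open>k\<close> only, never at
  \<open>k - 1\<close>. Hence a zero at \<open>0\<close> is included and one at \<open>n\<close> is
  not, and reversal needs an endpoint correction.\<close>

definition crossings :: "nat \<Rightarrow> (int \<Rightarrow> real) \<Rightarrow> int" where
  "crossings n u = (\<Sum>k = 0..<int n. crossing u k)"

definition riccati :: "(int \<Rightarrow> real) \<Rightarrow> (int \<Rightarrow> real) \<Rightarrow> int \<Rightarrow> real" where
  "riccati a u k = - a k * u (k + 1) / u k"

lemma crossings_Suc: "crossings (Suc k) u = crossings k u + crossing u (int k)"
proof -
  have "{0..<int (Suc k)} = insert (int k) {0..<int k}" by auto
  then show ?thesis by (simp add: crossings_def)
qed

lemma solution_zero_propagates:
  assumes "\<And>n. a n < 0" "\<And>n. tau a b u n = z * u n" "u k = 0" "u (k + 1) = 0"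
  shows "u n = 0"
proof -
  have "u n = 0 \<and> u (n + 1) = 0"
  proof (induction n rule: int_induct[where k = k])
    case base
    show ?case using assms by simp
  next
    case (step1 i)
    then show ?case
      using assms(2)[of "i + 1"] assms(1)[of "i + 1"] by (simp add: tau_def)
  next
    case (step2 i)
    then show ?case
      using assms(2)[of i] assms(1)[of "i - 1"] by (simp add: tau_def)
  qed
  then show ?thesis ..
qed

lemma solution_consecutive:
  assumes "\<And>n. a n < 0" "is_solution a b z u"
  shows "u k \<noteq> 0 \<or> u (k + 1) \<noteq> 0"
  using solution_zero_propagates[of a b u z k] assms unfolding is_solution_def by blast

section \<open>Weighted nodes telescope\<close>

text \<open>Here the Riccati variable of a solution is \<open>-\<infinity>\<close> at its zeros, and the sign of
  \<open>W * ui * uj\<close> is that of the difference of the two variables.\<close>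

definition riccati_below ::
  "(int \<Rightarrow> real) \<Rightarrow> (int \<Rightarrow> real) \<Rightarrow> (int \<Rightarrow> real) \<Rightarrow> (int \<Rightarrow> real) \<Rightarrow> int \<Rightarrow> int" where
  "riccati_below ai aj ui uj k =
     of_bool (ui k \<noteq> 0 \<and> (uj k = 0 \<or> wronskian ai aj ui uj k * ui k * uj k > 0))"

lemma zero_less_mult_neg_iff: "c < 0 \<Longrightarrow> 0 < x * c \<longleftrightarrow> x < 0" for x c :: real
  by (auto simp: zero_less_mult_iff)

lemma zero_less_mult_pos_iff: "0 < c \<Longrightarrow> 0 < x * c \<longleftrightarrow> 0 < x" for x c :: real
  by (auto simp: zero_less_mult_iff)

text \<open>With \<open>W\<close> held fixed, replacing the factors \<open>p * q\<close> by
  \<open>p' * q'\<close> changes the sign only if exactly one solution flips. In that case the two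
  summands in \<open>X\<close>, and likewise in \<open>Y\<close>, have equal signs, which fixes both
  signs.\<close>

lemma wronskian_sign_transfer:
  fixes a b p p' q q' :: real
  assumes "a < 0" "b < 0" "p' \<noteq> 0" "q' \<noteq> 0"
  defines "W \<equiv> p * b * q' - q * a * p'"
  shows "(of_bool (p \<noteq> 0 \<and> (q = 0 \<or> W * p * q > 0)) :: int) - of_bool (W * p' * q' > 0)
    = of_bool (q = 0 \<or> q * q' < 0) - of_bool (p = 0 \<or> p * p' < 0)"
proof -
  have X: "W * p' * q' = (p * p') * (b * q'\<^sup>2) - (q * q') * (a * p'\<^sup>2)"
    and Y: "W * p * q = (q * q') * (b * p\<^sup>2) - (p * p') * (a * q\<^sup>2)"
    unfolding W_def by (simp_all add: power2_eq_square algebra_simps)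
  have neg: "b * q'\<^sup>2 < 0" "a * p'\<^sup>2 < 0"
    using assms by (simp_all add: mult_neg_pos)
  have same: "w * x > 0 \<longleftrightarrow> w * y > 0" if "x * y > 0" for w x y :: real
    using that by (auto simp: zero_less_mult_iff)
  consider "p = 0" | "p \<noteq> 0" "q = 0" | "p * p' > 0" "q * q' > 0" | "p * p' > 0" "q * q' < 0"
    | "p * p' < 0" "q * q' > 0" | "p * p' < 0" "q * q' < 0"
    using assms(3,4) by (metis linorder_neqE_linordered_idom mult_eq_0_iff)
  then show ?thesis
  proof cases
    case 1
    then have "W * p' * q' = (q * q') * (- (a * p'\<^sup>2))" using X by simp
    then have "W * p' * q' > 0 \<longleftrightarrow> q * q' > 0"
      using neg(2) by (simp only: zero_less_mult_neg_iff zero_less_mult_pos_iff neg_0_less_iff_less)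
    with 1 assms(4) show ?thesis by (auto simp: not_less order_le_less)
  next
    case 2
    then have "W * p' * q' = (p * p') * (b * q'\<^sup>2)" using X by simp
    then have "W * p' * q' > 0 \<longleftrightarrow> p * p' < 0"
      using neg(1) by (simp only: zero_less_mult_neg_iff zero_less_mult_pos_iff neg_0_less_iff_less)
    with 2 show ?thesis by simp
  next
    case 3
    have "W * p * q > 0 \<longleftrightarrow> W * p' * q' > 0"
      using same[of "p * q" "p' * q'" W] mult_pos_pos[OF 3] by (simp add: mult_ac)
    with 3 show ?thesis by auto
  next
    case 4
    then have "b * p\<^sup>2 < 0" "a * q\<^sup>2 < 0"
      using assms by (auto intro!: mult_neg_pos)
    then have "W * p * q > 0" "W * p' * q' < 0"
      using 4 neg unfolding X Y by (smt (verit) mult_neg_neg mult_pos_neg)+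
    with 4 show ?thesis by auto
  next
    case 5
    then have "b * p\<^sup>2 < 0" "a * q\<^sup>2 < 0"
      using assms by (auto intro!: mult_neg_pos)
    then have "W * p * q < 0" "W * p' * q' > 0"
      using 5 neg unfolding X Y by (smt (verit) mult_neg_neg mult_pos_neg)+
    with 5 show ?thesis by auto
  next
    case 6
    have "W * p * q > 0 \<longleftrightarrow> W * p' * q' > 0"
      using same[of "p * q" "p' * q'" W] mult_neg_neg[OF 6] by (simp add: mult_ac)
    with 6 show ?thesis by auto
  qed
qed

lemma node_telescope:
  assumes "ai k < 0" "aj k < 0"
    and "ui k \<noteq> 0 \<or> ui (k + 1) \<noteq> 0" "uj k \<noteq> 0 \<or> uj (k + 1) \<noteq> 0"
  shows "node ai aj ui uj k = crossing uj k - crossing ui k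
    + (riccati_below ai aj ui uj (k + 1) - riccati_below ai aj ui uj k)"
proof -
  let ?W = "wronskian ai aj ui uj"
  consider "ui (k + 1) = 0" | "ui (k + 1) \<noteq> 0" "uj (k + 1) = 0"
    | "ui (k + 1) \<noteq> 0" "uj (k + 1) \<noteq> 0" by blast
  then show ?thesis
  proof cases
    \<comment> \<open>The node is 0 here, and \<open>riccati_below\<close> vanishes at
      \<open>k + 1\<close>; what remains is that \<open>riccati_below\<close> at \<open>k\<close>
      equals the crossing of \<open>uj\<close>.\<close>
    case 1
    then have "ui k \<noteq> 0" using assms by simp
    have "?W k * ui k * uj k = (uj k * uj (k + 1)) * (aj k * (ui k)\<^sup>2)"
      using 1 by (simp add: wronskian_def power2_eq_square algebra_simps)
    moreover have "aj k * (ui k)\<^sup>2 < 0"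
      using \<open>ui k \<noteq> 0\<close> assms by (simp add: mult_neg_pos)
    ultimately have "?W k * ui k * uj k > 0 \<longleftrightarrow> uj k * uj (k + 1) < 0"
      by (simp only: zero_less_mult_neg_iff)
    then show ?thesis
      using 1 \<open>ui k \<noteq> 0\<close> by (simp add: node_def crossing_def riccati_below_def)
  next
    \<comment> \<open>Again the node is 0, but \<open>riccati_below\<close> is 1 at
      \<open>k + 1\<close>, so \<open>riccati_below\<close> at \<open>k\<close> must be the
      complement of the crossing of \<open>ui\<close>.\<close>
    case 2
    then have "uj k \<noteq> 0" using assms by simp
    have "?W k * ui k * uj k = (ui k * ui (k + 1)) * - (ai k * (uj k)\<^sup>2)"
      using 2 by (simp add: wronskian_def power2_eq_square algebra_simps)
    moreover have "ai k * (uj k)\<^sup>2 < 0"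
      using \<open>uj k \<noteq> 0\<close> assms by (simp add: mult_neg_pos)
    ultimately have "?W k * ui k * uj k > 0 \<longleftrightarrow> ui k * ui (k + 1) > 0"
      by (simp only: zero_less_mult_pos_iff neg_0_less_iff_less)
    moreover have "(ui k \<noteq> 0 \<and> ui k * ui (k + 1) > 0) \<longleftrightarrow> \<not> (ui k = 0 \<or> ui k * ui (k + 1) < 0)"
      using 2 by (auto simp: not_less order_le_less)
    ultimately show ?thesis
      using 2 \<open>uj k \<noteq> 0\<close> by (simp add: node_def crossing_def riccati_below_def)
  next
    case 3
    \<comment> \<open>With \<open>s = ui (k + 1) * uj (k + 1)\<close>, the node is +1 when
      \<open>W * s\<close> becomes positive and -1 when it ceases to be positive.\<close>
    have signs: "(if w' * s > 0 \<and> (w * w' < 0 \<or> w = 0 \<and> w' \<noteq> 0) then 1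
        else if w * s > 0 \<and> (w * w' < 0 \<or> w \<noteq> 0 \<and> w' = 0) then - 1 else 0)
        = (of_bool (w' * s > 0) - of_bool (w * s > 0) :: int)" if "s \<noteq> 0" for s w w' :: real
      using that by (auto simp: zero_less_mult_iff mult_less_0_iff)
    have "node ai aj ui uj k = of_bool (?W (k + 1) * ui (k + 1) * uj (k + 1) > 0)
        - of_bool (?W k * ui (k + 1) * uj (k + 1) > 0)"
      using signs[of "ui (k + 1) * uj (k + 1)" "?W (k + 1)" "?W k"] 3
      unfolding node_def Let_def mult.assoc by simp
    then show ?thesis
      using 3 wronskian_sign_transfer[OF assms(1,2) 3, of "ui k" "uj k"]
      by (simp add: crossing_def riccati_below_def wronskian_def)
  qed
qed

lemma nodes_cc_crossings:
  assumes "\<And>n. ai n < 0" "\<And>n. aj n < 0"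
    and "is_solution ai bi z ui" "is_solution aj bj z uj"
  shows "nodes_cc ai aj ui uj 0 (int N) = crossings N uj - crossings N ui
    + (riccati_below ai aj ui uj (int N) - riccati_below ai aj ui uj 0)"
proof (induction N)
  case 0
  then show ?case by (simp add: nodes_cc_def crossings_def)
next
  case (Suc N)
  have "{0..<int (Suc N)} = insert (int N) {0..<int N}" by auto
  then have "nodes_cc ai aj ui uj 0 (int (Suc N))
      = nodes_cc ai aj ui uj 0 (int N) + node ai aj ui uj (int N)"
    by (simp add: nodes_cc_def)
  moreover have "node ai aj ui uj (int N) = crossing uj (int N) - crossing ui (int N)
      + (riccati_below ai aj ui uj (int N + 1) - riccati_below ai aj ui uj (int N))"
    using assms(1,2) solution_consecutive[OF assms(1,3)] solution_consecutive[OF assms(2,4)]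
    by (intro node_telescope)
  ultimately show ?case
    using Suc by (simp add: crossings_Suc add.commute)
qed

section \<open>Pivots of a positive semidefinite tridiagonal form\<close>

text \<open>Vectors are extended by zero at \<open>0\<close> and \<open>N\<close>, which makes the form invariant under
  reversing the order of the entries.\<close>

definition tridiag_nonneg :: "nat \<Rightarrow> (int \<Rightarrow> real) \<Rightarrow> (int \<Rightarrow> real) \<Rightarrow> bool" where
  "tridiag_nonneg N \<alpha> \<delta> \<longleftrightarrow> (\<forall>v :: int \<Rightarrow> real. v 0 = 0 \<longrightarrow> v (int N) = 0 \<longrightarrow>
     0 \<le> (\<Sum>k = 1..<int N. \<delta> k * (v k)\<^sup>2) + 2 * (\<Sum>k = 0..<int N. \<alpha> k * v k * v (k + 1)))"

text \<open>Division by zero gives zero, so that a vanishing pivot leaves the next diagonal entry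
  unchanged; in particular the first pivot is \<open>\<delta> 1\<close>.\<close>

fun pivot :: "(int \<Rightarrow> real) \<Rightarrow> (int \<Rightarrow> real) \<Rightarrow> nat \<Rightarrow> real" where
  "pivot \<alpha> \<delta> 0 = 0"
| "pivot \<alpha> \<delta> (Suc k) = \<delta> (int (Suc k)) - (\<alpha> (int k))\<^sup>2 / pivot \<alpha> \<delta> k"

text \<open>Nonnegativity of the Schur complement: the entries before \<open>k\<close> are
  eliminated, and the diagonal entry at \<open>k\<close> has become the pivot.\<close>

definition remainder_nonneg :: "nat \<Rightarrow> (int \<Rightarrow> real) \<Rightarrow> (int \<Rightarrow> real) \<Rightarrow> nat \<Rightarrow> bool" where
  "remainder_nonneg N \<alpha> \<delta> k \<longleftrightarrow> (\<forall>v :: int \<Rightarrow> real. v (int N) = 0 \<longrightarrow> (k = 0 \<longrightarrow> v 0 = 0) \<longrightarrow>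
     0 \<le> pivot \<alpha> \<delta> k * (v (int k))\<^sup>2 + (\<Sum>j = int k + 1..<int N. \<delta> j * (v j)\<^sup>2)
       + 2 * (\<Sum>j = int k..<int N. \<alpha> j * v j * v (j + 1)))"

lemma remainder_pivot_nonneg:
  assumes "remainder_nonneg N \<alpha> \<delta> k" "k < N"
  shows "pivot \<alpha> \<delta> k \<ge> 0"
proof (cases "k = 0")
  case False
  \<comment> \<open>The form at the unit vector at \<open>k\<close> is the pivot itself.\<close>
  have "(\<Sum>j = int k + 1..<int N. \<delta> j * (of_bool (j = int k))\<^sup>2) = 0"
    by (rule sum.neutral) auto
  moreover have "(\<Sum>j = int k..<int N. \<alpha> j * of_bool (j = int k) * of_bool (j + 1 = int k)) = 0"
    by (rule sum.neutral) auto
  ultimately show ?thesis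
    using assms(1)[unfolded remainder_nonneg_def, rule_format, of "\<lambda>j. of_bool (j = int k)"] assms(2) False
    by simp
qed simp

lemma remainder_pivot_zero:
  assumes "remainder_nonneg N \<alpha> \<delta> k" "0 < k" "k + 1 < N" "pivot \<alpha> \<delta> k = 0"
  shows "\<alpha> (int k) = 0"
proof (rule ccontr)
  assume nz: "\<alpha> (int k) \<noteq> 0"
  \<comment> \<open>This \<open>t\<close> makes the coupling term
    \<open>-(\<bar>\<delta> (int k + 1)\<bar> + 1)\<close>, so with a zero pivot the form would be
    at most -1.\<close>
  define t where "t = - (\<bar>\<delta> (int k + 1)\<bar> + 1) / (2 * \<alpha> (int k))"
  define v where "v = (\<lambda>j. if j = int k then t else if j = int k + 1 then 1 else 0 :: real)"
  have "(\<Sum>j = int k + 1..<int N. \<delta> j * (v j)\<^sup>2)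
      = (\<Sum>j \<in> {int k + 1}. \<delta> j * (v j)\<^sup>2)"
    using assms by (intro sum.mono_neutral_right) (auto simp: v_def)
  moreover have "(\<Sum>j = int k..<int N. \<alpha> j * v j * v (j + 1))
      = (\<Sum>j \<in> {int k}. \<alpha> j * v j * v (j + 1))"
    using assms by (intro sum.mono_neutral_right) (auto simp: v_def)
  moreover have "v (int N) = 0" using assms by (simp add: v_def)
  ultimately have "0 \<le> \<delta> (int k + 1) + 2 * (\<alpha> (int k) * t)"
    using assms(1)[unfolded remainder_nonneg_def, rule_format, of v] assms(2,4)
    by (simp add: v_def)
  moreover have "2 * (\<alpha> (int k) * t) = - (\<bar>\<delta> (int k + 1)\<bar> + 1)"
    using nz by (simp add: t_def)
  ultimately show False by linarith
qed

lemma remainder_nonneg_Suc: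
  assumes "remainder_nonneg N \<alpha> \<delta> k" "Suc k < N"
  shows "remainder_nonneg N \<alpha> \<delta> (Suc k)"
  unfolding remainder_nonneg_def
proof (intro allI impI)
  fix v :: "int \<Rightarrow> real"
  assume vN: "v (int N) = 0"
  \<comment> \<open>Completing the square: for a positive pivot this entry minimises the form. For a
    zero pivot it defaults to 0, matching the convention in \<open>pivot\<close>; at
    \<open>k = 0\<close> this also respects the constraint \<open>v 0 = 0\<close>.\<close>
  define w where "w = v(int k := - \<alpha> (int k) * v (int k + 1) / pivot \<alpha> \<delta> k)"
  have wv: "w j = v j" if "j > int k" for j
    using that by (simp add: w_def)
  have "0 \<le> pivot \<alpha> \<delta> k * (w (int k))\<^sup>2 + (\<Sum>j = int k + 1..<int N. \<delta> j * (w j)\<^sup>2)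
       + 2 * (\<Sum>j = int k..<int N. \<alpha> j * w j * w (j + 1))"
    using assms(1)[unfolded remainder_nonneg_def, rule_format, of w] assms(2) vN
    by (cases k) (simp_all add: w_def)
  moreover have "{int k + 1..<int N} = insert (int k + 1) {int k + 2..<int N}"
    "{int k..<int N} = insert (int k) {int k + 1..<int N}"
    using assms(2) by auto
  moreover have "(\<Sum>j = int k + 2..<int N. \<delta> j * (w j)\<^sup>2) = (\<Sum>j = int k + 2..<int N. \<delta> j * (v j)\<^sup>2)"
    "(\<Sum>j = int k + 1..<int N. \<alpha> j * w j * w (j + 1)) = (\<Sum>j = int k + 1..<int N. \<alpha> j * v j * v (j + 1))"
    by (auto intro!: sum.cong simp: wv)
  ultimately have "0 \<le> pivot \<alpha> \<delta> k * (w (int k))\<^sup>2 + 2 * (\<alpha> (int k) * w (int k) * v (int k + 1))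
      + \<delta> (int k + 1) * (v (int k + 1))\<^sup>2
      + (\<Sum>j = int k + 2..<int N. \<delta> j * (v j)\<^sup>2) + 2 * (\<Sum>j = int k + 1..<int N. \<alpha> j * v j * v (j + 1))"
    by (simp add: wv)
  moreover have "pivot \<alpha> \<delta> k * (w (int k))\<^sup>2 + 2 * (\<alpha> (int k) * w (int k) * v (int k + 1))
      = - (\<alpha> (int k))\<^sup>2 / pivot \<alpha> \<delta> k * (v (int k + 1))\<^sup>2"
    by (cases "pivot \<alpha> \<delta> k = 0") (simp_all add: w_def power2_eq_square field_simps)
  ultimately show "0 \<le> pivot \<alpha> \<delta> (Suc k) * (v (int (Suc k)))\<^sup>2
      + (\<Sum>j = int (Suc k) + 1..<int N. \<delta> j * (v j)\<^sup>2)
      + 2 * (\<Sum>j = int (Suc k)..<int N. \<alpha> j * v j * v (j + 1))"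
    by (simp add: algebra_simps)
qed

lemma tridiag_nonneg_remainder:
  assumes "tridiag_nonneg N \<alpha> \<delta>" "k < N"
  shows "remainder_nonneg N \<alpha> \<delta> k"
  using assms(2)
proof (induction k)
  case 0
  then show ?case
    using assms(1) by (auto simp: tridiag_nonneg_def remainder_nonneg_def)
qed (simp add: remainder_nonneg_Suc)

text \<open>The coefficient \<open>\<alpha> k\<close> belongs to the edge from \<open>k\<close> to
  \<open>k + 1\<close>, so edges reflect by \<open>N - 1 - k\<close> while sites reflect by
  \<open>N - k\<close>.\<close>

lemma tridiag_nonneg_reflect:
  assumes "tridiag_nonneg N \<alpha> \<delta>"
  shows "tridiag_nonneg N (\<lambda>k. \<alpha> (int N - 1 - k)) (\<lambda>k. \<delta> (int N - k))"
  unfolding tridiag_nonneg_def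
proof (intro allI impI)
  fix v :: "int \<Rightarrow> real"
  assume "v 0 = 0" "v (int N) = 0"
  then have "0 \<le> (\<Sum>k = 1..<int N. \<delta> k * (v (int N - k))\<^sup>2)
      + 2 * (\<Sum>k = 0..<int N. \<alpha> k * v (int N - k) * v (int N - (k + 1)))"
    using assms[unfolded tridiag_nonneg_def, rule_format, of "\<lambda>k. v (int N - k)"] by simp
  moreover have "(\<Sum>k = 1..<int N. \<delta> k * (v (int N - k))\<^sup>2)
      = (\<Sum>k = 1..<int N. \<delta> (int N - k) * (v k)\<^sup>2)"
    by (rule sum.reindex_bij_witness[of _ "\<lambda>k. int N - k" "\<lambda>k. int N - k"]) auto
  moreover have "(\<Sum>k = 0..<int N. \<alpha> k * v (int N - k) * v (int N - (k + 1)))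
      = (\<Sum>k = 0..<int N. \<alpha> (int N - 1 - k) * v k * v (k + 1))"
    by (rule sum.reindex_bij_witness[of _ "\<lambda>k. int N - 1 - k" "\<lambda>k. int N - 1 - k"])
      (auto simp: algebra_simps)
  ultimately show "0 \<le> (\<Sum>k = 1..<int N. \<delta> (int N - k) * (v k)\<^sup>2)
      + 2 * (\<Sum>k = 0..<int N. \<alpha> (int N - 1 - k) * v k * v (k + 1))"
    by simp
qed

section \<open>From the Jacobi matrices to the tridiagonal form\<close>

lemma sum_tridiag:
  fixes v :: "int \<Rightarrow> real"
  shows "(\<Sum>i<n. \<Sum>j<n. v (int i + 1) * ((if i = j then \<delta> (int i + 1)
      else if j = i + 1 then \<alpha> (int i + 1) else if i = j + 1 then \<alpha> (int j + 1) else 0) * v (int j + 1)))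
    = (\<Sum>k = 1..int n. \<delta> k * (v k)\<^sup>2) + 2 * (\<Sum>k = 1..<int n. \<alpha> k * v k * v (k + 1))"
    (is "(\<Sum>i<n. \<Sum>j<n. ?T i j) = _")
proof (induction n)
  case (Suc n)
  have split: "(\<Sum>i<Suc n. \<Sum>j<Suc n. ?T i j)
      = (\<Sum>i<n. \<Sum>j<n. ?T i j) + (\<Sum>i<n. ?T i n) + (\<Sum>j<n. ?T n j) + ?T n n"
    by (simp add: sum.distrib)
  show ?case
  proof (cases n)
    \<comment> \<open>The bordering row and column meet the old block only at index
      \<open>m\<close>, which yields the doubled coupling term.\<close>
    case (Suc m)
    have "(\<Sum>i<n. ?T i n) = (\<Sum>i \<in> {m}. ?T i n)" "(\<Sum>j<n. ?T n j) = (\<Sum>j \<in> {m}. ?T n j)"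
      using Suc by (auto intro!: sum.mono_neutral_right)
    moreover have "{1..int (Suc n)} = insert (int n + 1) {1..int n}"
      "{1..<int (Suc n)} = insert (int n) {1..<int n}"
      using Suc by auto
    ultimately show ?thesis
      unfolding split Suc.IH using Suc
      by (simp add: power2_eq_square algebra_simps)
  qed (simp add: power2_eq_square)
qed simp

lemma jacobi_diff_tridiag_nonneg:
  assumes "N \<ge> 1" "positive_semidefinite (jacobi_mat N a1 b1 - jacobi_mat N a2 b2)"
  shows "tridiag_nonneg N (\<lambda>k. a1 k - a2 k) (\<lambda>k. b1 k - b2 k)"
  unfolding tridiag_nonneg_def
proof (intro allI impI)
  fix v :: "int \<Rightarrow> real"
  assume v: "v 0 = 0" "v (int N) = 0"
  define n where "n = N - 1"
  define A where "A = jacobi_mat N a1 b1 - jacobi_mat N a2 b2"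
  define x where "x = vec n (\<lambda>i. v (int i + 1))"
  have dim: "A \<in> carrier_mat n n" "x \<in> carrier_vec n"
    by (auto simp: A_def x_def jacobi_mat_def n_def)
  have entry: "A $$ (i, j) = (if i = j then b1 (int i + 1) - b2 (int i + 1)
      else if j = i + 1 then a1 (int i + 1) - a2 (int i + 1)
      else if i = j + 1 then a1 (int j + 1) - a2 (int j + 1) else 0)"
    if "i < n" "j < n" for i j
    using that by (simp add: A_def jacobi_mat_def n_def)
  have "0 \<le> x \<bullet> (A *\<^sub>v x)"
    using assms(2) dim unfolding positive_semidefinite_def A_def[symmetric] by auto
  also have "x \<bullet> (A *\<^sub>v x) = (\<Sum>i<n. \<Sum>j<n. v (int i + 1) * (A $$ (i, j) * v (int j + 1)))"
    using dim by (simp add: scalar_prod_def x_def sum_distrib_left atLeast0LessThan)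
  also have "\<dots> = (\<Sum>k = 1..int n. (b1 k - b2 k) * (v k)\<^sup>2)
      + 2 * (\<Sum>k = 1..<int n. (a1 k - a2 k) * v k * v (k + 1))"
    unfolding sum_tridiag[where \<delta> = "\<lambda>k. b1 k - b2 k" and \<alpha> = "\<lambda>k. a1 k - a2 k", symmetric]
    by (intro sum.cong refl) (simp add: entry)
  also have "{1..int n} = {1..<int N}"
    using assms(1) by (auto simp: n_def)
  \<comment> \<open>The extra edges at \<open>0\<close> and \<open>N - 1\<close> contribute nothing
    because \<open>v\<close> vanishes at \<open>0\<close> and \<open>N\<close>.\<close>
  also have "(\<Sum>k = 1..<int n. (a1 k - a2 k) * v k * v (k + 1))
      = (\<Sum>k = 0..<int N. (a1 k - a2 k) * v k * v (k + 1))"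
  proof (rule sum.mono_neutral_left)
    show "\<forall>k \<in> {0..<int N} - {1..<int n}. (a1 k - a2 k) * v k * v (k + 1) = 0"
    proof
      fix k assume "k \<in> {0..<int N} - {1..<int n}"
      then have "k = 0 \<or> k + 1 = int N" using assms(1) by (auto simp: n_def)
      then show "(a1 k - a2 k) * v k * v (k + 1) = 0" using v by auto
    qed
  qed (auto simp: n_def)
  finally show "0 \<le> (\<Sum>k = 1..<int N. (b1 k - b2 k) * (v k)\<^sup>2)
      + 2 * (\<Sum>k = 0..<int N. (a1 k - a2 k) * v k * v (k + 1))" .
qed

section \<open>Comparison of crossing counts\<close>

text \<open>The lifted Riccati variables, ordered first by the number of crossings and then by
  decreasing value, with \<open>-\<infinity>\<close> at the zeros (\<open>p = 0\<close>) of the solution.\<close>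

definition riccati_le :: "real \<Rightarrow> int \<Rightarrow> real \<Rightarrow> real \<Rightarrow> int \<Rightarrow> real \<Rightarrow> real \<Rightarrow> bool" where
  "riccati_le d n1 p1 r1 n2 p2 r2 \<longleftrightarrow>
     n1 < n2 \<or> n1 = n2 \<and> (p2 = 0 \<or> p1 \<noteq> 0 \<and> r2 + d \<le> r1)"

text \<open>Cauchy-Schwarz: the difference for denominator \<open>x + y\<close> is a square over a
  positive number. If \<open>y = 0\<close>, the default value of the last quotient is correct
  because \<open>t = 0\<close>.\<close>

lemma parallel_sum_le:
  fixes x y z s t :: real
  assumes "0 < x" "0 \<le> y" "x + y \<le> z" "y = 0 \<Longrightarrow> t = 0"
  shows "(s + t)\<^sup>2 / z \<le> s\<^sup>2 / x + t\<^sup>2 / y"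
proof -
  have "(s + t)\<^sup>2 / z \<le> (s + t)\<^sup>2 / (x + y)"
    using assms by (intro divide_left_mono) auto
  also have "\<dots> \<le> s\<^sup>2 / x + t\<^sup>2 / y"
  proof (cases "y = 0")
    case False
    then have "y > 0" using assms by simp
    have "s\<^sup>2 / x + t\<^sup>2 / y - (s + t)\<^sup>2 / (x + y) = (s * y - t * x)\<^sup>2 / (x * y * (x + y))"
      using assms(1) \<open>y > 0\<close> by (simp add: divide_simps power2_eq_square) (simp add: algebra_simps)
    also have "\<dots> \<ge> 0" using assms(1) \<open>y > 0\<close> by simp
    finally show ?thesis by simp
  qed (use assms in simp)
  finally show ?thesis .
qed

text \<open>One elimination step: unprimed values belong to \<open>k\<close>, primed ones to
  \<open>k + 1\<close>, and the new gap is the next pivot. A Riccati variable is stored as 0 at a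
  zero, so the default quotient restarts it at \<open>c1\<close> or \<open>c2\<close>.\<close>

lemma riccati_le_step:
  fixes a1 a2 c1 c2 d :: real
  assumes le: "riccati_le d n1 p1 r1 n2 p2 r2"
    and r0: "p1 = 0 \<Longrightarrow> r1 = 0" "p2 = 0 \<Longrightarrow> r2 = 0"
    and p': "p1' = 0 \<longleftrightarrow> p1 \<noteq> 0 \<and> r1 = 0" "p2' = 0 \<longleftrightarrow> p2 \<noteq> 0 \<and> r2 = 0"
    and r': "p1' \<noteq> 0 \<Longrightarrow> r1' = c1 - a1\<^sup>2 / r1" "p2' \<noteq> 0 \<Longrightarrow> r2' = c2 - a2\<^sup>2 / r2"
    and d: "0 \<le> d" "p1 \<noteq> 0 \<Longrightarrow> d = 0 \<Longrightarrow> a1 = a2"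
  shows "riccati_le (c1 - c2 - (a1 - a2)\<^sup>2 / d)
    (n1 + of_bool (p1 = 0 \<or> r1 < 0)) p1' r1' (n2 + of_bool (p2 = 0 \<or> r2 < 0)) p2' r2'"
proof -
  let ?s1 = "p1 = 0 \<or> r1 < 0" and ?s2 = "p2 = 0 \<or> r2 < 0"
  have dpos: "(a1 - a2)\<^sup>2 / d \<ge> 0" using d by simp
  have suff: ?thesis if "n1 + of_bool ?s1 \<le> n2 + of_bool ?s2"
    "n1 + of_bool ?s1 = n2 + of_bool ?s2 \<Longrightarrow> p2' \<noteq> 0 \<Longrightarrow>
      p1' \<noteq> 0 \<and> a1\<^sup>2 / r1 \<le> a2\<^sup>2 / r2 + (a1 - a2)\<^sup>2 / d"
    using that r' unfolding riccati_le_def by (smt (verit))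
  consider (lead) "n1 < n2" | (zero) "n1 = n2" "p2 = 0"
    | (fin) "n1 = n2" "p2 \<noteq> 0" "p1 \<noteq> 0" "r2 + d \<le> r1"
    using le unfolding riccati_le_def by blast
  then show ?thesis
  proof cases
    \<comment> \<open>A tie arises only if the first solution crosses and the second does not; the
      signs of the quotients then suffice.\<close>
    case lead
    show ?thesis
    proof (rule suff)
      show "n1 + of_bool ?s1 \<le> n2 + of_bool ?s2" using lead by (auto simp: of_bool_def)
    next
      assume "n1 + of_bool ?s1 = n2 + of_bool ?s2" "p2' \<noteq> 0"
      then have "?s1" "\<not> ?s2" using lead by (auto simp: of_bool_def split: if_splits)
      then have "p1' \<noteq> 0" "r1 \<le> 0" "r2 \<ge> 0" using p' r0 by auto
      then have "a1\<^sup>2 / r1 \<le> 0" "a2\<^sup>2 / r2 \<ge> 0" by (auto simp: divide_nonneg_nonpos)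
      then show "p1' \<noteq> 0 \<and> a1\<^sup>2 / r1 \<le> a2\<^sup>2 / r2 + (a1 - a2)\<^sup>2 / d"
        using \<open>p1' \<noteq> 0\<close> dpos by linarith
    qed
  next
    case zero
    show ?thesis
    proof (rule suff)
      show "n1 + of_bool ?s1 \<le> n2 + of_bool ?s2" using zero by (auto simp: of_bool_def)
    next
      assume "n1 + of_bool ?s1 = n2 + of_bool ?s2"
      then have "?s1" using zero by (auto simp: of_bool_def split: if_splits)
      then have "p1' \<noteq> 0" "r1 \<le> 0" using p' r0 by auto
      then have "a1\<^sup>2 / r1 \<le> 0" by (auto simp: divide_nonneg_nonpos)
      then show "p1' \<noteq> 0 \<and> a1\<^sup>2 / r1 \<le> a2\<^sup>2 / r2 + (a1 - a2)\<^sup>2 / d"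
        using \<open>p1' \<noteq> 0\<close> dpos zero r0 by simp
    qed
  next
    \<comment> \<open>In a tie \<open>r1\<close> and \<open>r2\<close> have the same strict sign.
      The one of larger modulus exceeds the other by at least \<open>d\<close>, so it serves as
      \<open>z\<close> in \<open>parallel_sum_le\<close>.\<close>
    case fin
    show ?thesis
    proof (rule suff)
      show "n1 + of_bool ?s1 \<le> n2 + of_bool ?s2" using fin d by (auto simp: of_bool_def)
    next
      assume "n1 + of_bool ?s1 = n2 + of_bool ?s2" "p2' \<noteq> 0"
      then have "?s1 \<longleftrightarrow> ?s2" "r2 \<noteq> 0"
        using fin p' by (auto simp: of_bool_def split: if_splits)
      then consider "r1 < 0" "r2 < 0" | "r2 > 0" "r1 > 0"
        using fin d by force
      then show "p1' \<noteq> 0 \<and> a1\<^sup>2 / r1 \<le> a2\<^sup>2 / r2 + (a1 - a2)\<^sup>2 / d"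
      proof cases
        case 1
        then have "(a1 + (a2 - a1))\<^sup>2 / (- r2) \<le> a1\<^sup>2 / (- r1) + (a2 - a1)\<^sup>2 / d"
          using fin d by (intro parallel_sum_le) auto
        then show ?thesis
          using 1 p' by (simp add: power2_commute[of a2 a1])
      next
        case 2
        then have "(a2 + (a1 - a2))\<^sup>2 / r1 \<le> a2\<^sup>2 / r2 + (a1 - a2)\<^sup>2 / d"
          using fin d by (intro parallel_sum_le) auto
        then show ?thesis
          using 2 p' by simp
      qed
    qed
  qed
qed

lemma crossing_riccati:
  assumes "a k < 0"
  shows "crossing u k = of_bool (u k = 0 \<or> riccati a u k < 0)"
  using assms
  by (auto simp: crossing_def riccati_def mult_less_0_iff zero_less_mult_iff divide_less_0_iff
      zero_less_divide_iff)

text \<open>The recurrence at \<open>k + 1\<close> is divided by \<open>u (k + 1)\<close>. If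
  \<open>u k = 0\<close>, the default quotient 0 is the true value of the term with
  \<open>a k * u k\<close>.\<close>

lemma riccati_step:
  assumes "\<And>n. a n < 0" "is_solution a b z u" "u (k + 1) \<noteq> 0"
  shows "riccati a u (k + 1) = b (k + 1) - z - (a k)\<^sup>2 / riccati a u k"
proof -
  have "a (k + 1) * u (k + 2) + a k * u k + b (k + 1) * u (k + 1) = z * u (k + 1)"
    using assms(2) unfolding is_solution_def tau_def by (metis add.assoc add_diff_cancel one_add_one)
  then have "- a (k + 1) * u (k + 2) = a k * u k + (b (k + 1) - z) * u (k + 1)"
    by (simp add: algebra_simps)
  then have "riccati a u (k + 1) = (a k * u k + (b (k + 1) - z) * u (k + 1)) / u (k + 1)"
    by (simp add: riccati_def add.commute add.left_commute)
  also have "\<dots> = b (k + 1) - z - (a k)\<^sup>2 / riccati a u k"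
    using assms(3) assms(1)[of k]
    by (cases "u k = 0") (simp_all add: riccati_def field_simps power2_eq_square)
  finally show ?thesis .
qed

lemma crossings_compare:
  assumes neg: "\<And>n. a1 n < 0" "\<And>n. a2 n < 0"
    and sol: "is_solution a1 b1 z u1" "is_solution a2 b2 z u2"
    and init: "u1 0 = 0" "u2 0 = 0"
    and psd: "tridiag_nonneg N (\<lambda>k. a1 k - a2 k) (\<lambda>k. b1 k - b2 k)"
    and "N \<ge> 1"
  shows "crossings N u1 \<le> crossings N u2"
    and "crossings N u1 + of_bool (u1 (int N) = 0) \<le> crossings N u2 + of_bool (u2 (int N) = 0)"
proof -
  let ?r1 = "riccati a1 u1" and ?r2 = "riccati a2 u2"
  let ?d = "pivot (\<lambda>k. a1 k - a2 k) (\<lambda>k. b1 k - b2 k)"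
  have zero: "riccati a u k = 0" if "u k = 0" for a u k
    using that by (simp add: riccati_def)
  have next_zero: "u1 (k + 1) = 0 \<longleftrightarrow> u1 k \<noteq> 0 \<and> ?r1 k = 0"
    "u2 (k + 1) = 0 \<longleftrightarrow> u2 k \<noteq> 0 \<and> ?r2 k = 0" for k
    using solution_consecutive[OF neg(1) sol(1), of k] solution_consecutive[OF neg(2) sol(2), of k]
      neg(1)[of k] neg(2)[of k] by (auto simp: riccati_def)
  have d_nonneg: "?d k \<ge> 0" if "k < N" for k
    using that psd tridiag_nonneg_remainder remainder_pivot_nonneg by blast
  have le: "riccati_le (?d k) (crossings k u1) (u1 (int k)) (?r1 (int k))
      (crossings k u2) (u2 (int k)) (?r2 (int k))" if "k < N" for k
    using that
  proof (induction k)
    case 0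
    then show ?case using init by (simp add: riccati_le_def crossings_def)
  next
    case (Suc k)
    have eq: "a1 (int k) = a2 (int k)" if "u1 (int k) \<noteq> 0" "?d k = 0"
    proof -
      \<comment> \<open>The artificial pivot 0 at index 0 is harmless, since \<open>u1\<close>
        vanishes there.\<close>
      have "k > 0" using that init by (cases k) auto
      then show ?thesis
        using remainder_pivot_zero[OF tridiag_nonneg_remainder[OF psd, of k]] Suc.prems that by simp
    qed
    have "riccati_le (b1 (int k + 1) - z - (b2 (int k + 1) - z) - (a1 (int k) - a2 (int k))\<^sup>2 / ?d k)
        (crossings k u1 + of_bool (u1 (int k) = 0 \<or> ?r1 (int k) < 0)) (u1 (int k + 1)) (?r1 (int k + 1))
        (crossings k u2 + of_bool (u2 (int k) = 0 \<or> ?r2 (int k) < 0)) (u2 (int k + 1)) (?r2 (int k + 1))"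
      using Suc d_nonneg[of k] next_zero eq
      by (intro riccati_le_step[where ?p1.0 = "u1 (int k)" and ?p2.0 = "u2 (int k)"
            and ?r1.0 = "?r1 (int k)" and ?r2.0 = "?r2 (int k)"])
        (simp_all add: zero riccati_step[OF neg(1) sol(1)] riccati_step[OF neg(2) sol(2)])
    then show ?case
      by (simp add: crossings_Suc crossing_riccati[of a1 _ u1, OF neg(1)] crossing_riccati[of a2 _ u2, OF neg(2)]
          add.commute)
  qed
  obtain k where k: "N = Suc k" using \<open>N \<ge> 1\<close> by (cases N) auto
  text \<open>The last step does not involve the coefficients at \<open>N - 1\<close> and \<open>N\<close>, which lie outside
    the matrices, so they may be chosen equal.\<close>
  have "riccati_le (0 - 0 - (1 - 1)\<^sup>2 / ?d k)
      (crossings k u1 + of_bool (u1 (int k) = 0 \<or> ?r1 (int k) < 0)) (u1 (int k + 1))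
      (0 - 1\<^sup>2 / ?r1 (int k))
      (crossings k u2 + of_bool (u2 (int k) = 0 \<or> ?r2 (int k) < 0)) (u2 (int k + 1))
      (0 - 1\<^sup>2 / ?r2 (int k))"
    using le[of k] d_nonneg[of k] next_zero k
    by (intro riccati_le_step[where ?p1.0 = "u1 (int k)" and ?p2.0 = "u2 (int k)"])
      (simp_all add: zero)
  then have "crossings N u1 < crossings N u2 \<or>
      crossings N u1 = crossings N u2 \<and> (u2 (int N) = 0 \<or> u1 (int N) \<noteq> 0)"
    by (auto simp: k riccati_le_def crossings_Suc crossing_riccati[of a1 _ u1, OF neg(1)]
        crossing_riccati[of a2 _ u2, OF neg(2)] add.commute)
  \<comment> \<open>In a tie a zero of \<open>u1\<close> at \<open>N\<close> forces one of
    \<open>u2\<close>; a strict inequality of integers absorbs the endpoint term.\<close>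
  then show "crossings N u1 \<le> crossings N u2"
    and "crossings N u1 + of_bool (u1 (int N) = 0) \<le> crossings N u2 + of_bool (u2 (int N) = 0)"
    by (auto simp: of_bool_def)
qed

section \<open>Reflection of the interval\<close>

lemma is_solution_reflect:
  assumes "is_solution a b z u"
  shows "is_solution (\<lambda>k. a (m - 1 - k)) (\<lambda>k. b (m - k)) z (\<lambda>k. u (m - k))"
proof -
  have "tau (\<lambda>k. a (m - 1 - k)) (\<lambda>k. b (m - k)) (\<lambda>k. u (m - k)) n = tau a b u (m - n)" for n
    by (simp add: tau_def algebra_simps)
  moreover obtain n where "u n \<noteq> 0" using assms by (auto simp: is_solution_def)
  then have "u (m - (m - n)) \<noteq> 0" by simp
  ultimately show ?thesis
    using assms unfolding is_solution_def by metis
qed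

lemma crossings_reflect:
  "crossings N (\<lambda>k. u (int N - k)) + of_bool (u 0 = 0) = crossings N u + of_bool (u (int N) = 0)"
proof -
  define flips where "flips = (\<Sum>k = 0..<int N. of_bool (u k * u (k + 1) < 0) :: int)"
  \<comment> \<open>Zeros and strict sign changes are disjoint events. Sign changes are invariant
    under reversal; zeros are compared by completing both ranges to \<open>0..N\<close>.\<close>
  have crossing: "crossing w k = of_bool (w k = 0) + of_bool (w k * w (k + 1) < 0)" for w k
    by (auto simp: crossing_def)
  have "(\<Sum>k = 0..<int N. of_bool (u (int N - k) * u (int N - (k + 1)) < 0) :: int) = flips"
    unfolding flips_def
    by (rule sum.reindex_bij_witness[of _ "\<lambda>k. int N - 1 - k" "\<lambda>k. int N - 1 - k"])
      (auto simp: algebra_simps)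
  moreover have "(\<Sum>k = 0..<int N. of_bool (u (int N - k) = 0) :: int)
      = (\<Sum>k = 1..int N. of_bool (u k = 0))"
    by (rule sum.reindex_bij_witness[of _ "\<lambda>k. int N - k" "\<lambda>k. int N - k"]) auto
  moreover have "(\<Sum>k = 1..int N. of_bool (u k = 0) :: int) + of_bool (u 0 = 0)
      = (\<Sum>k = 0..int N. of_bool (u k = 0))"
  proof -
    have "{0..int N} = insert 0 {1..int N}" by auto
    then show ?thesis by (simp only: sum.insert) simp
  qed
  moreover have "(\<Sum>k = 0..<int N. of_bool (u k = 0) :: int) + of_bool (u (int N) = 0)
      = (\<Sum>k = 0..int N. of_bool (u k = 0))"
  proof -
    have "{0..int N} = insert (int N) {0..<int N}" by auto
    then show ?thesis by simp
  qed
  ultimately show ?thesis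
    by (simp add: crossings_def crossing sum.distrib flips_def)
qed

text \<open>Reversal turns a count into the original plus 1 minus the indicator of a zero at
  \<open>0\<close>. The two claims of \<open>crossings_compare\<close> therefore yield these two in
  swapped order.\<close>

lemma crossings_compare_reflect:
  assumes neg: "\<And>n. a1 n < 0" "\<And>n. a2 n < 0"
    and sol: "is_solution a1 b1 z u1" "is_solution a2 b2 z u2"
    and final: "u1 (int N) = 0" "u2 (int N) = 0"
    and psd: "tridiag_nonneg N (\<lambda>k. a1 k - a2 k) (\<lambda>k. b1 k - b2 k)"
    and "N \<ge> 1"
  shows "crossings N u1 \<le> crossings N u2"
    and "crossings N u1 - of_bool (u1 0 = 0) \<le> crossings N u2 - of_bool (u2 0 = 0)"
  using crossings_compare[OF neg(1) neg(2) is_solution_reflect[OF sol(1), of "int N"]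
      is_solution_reflect[OF sol(2), of "int N"] _ _ tridiag_nonneg_reflect[OF psd] \<open>N \<ge> 1\<close>]
    crossings_reflect[of N u1] crossings_reflect[of N u2] final
  by simp_all

section \<open>Assembly of the inequalities\<close>

theorem theorem5p1:
  fixes N :: nat and l :: real
    and a b um up :: "nat \<Rightarrow> int \<Rightarrow> real"
  assumes "N \<ge> 2"
    and "\<And>j n. j \<in> {0, 1, 2} \<Longrightarrow> a j n < 0"
    and "\<And>j. j \<in> {0, 1, 2} \<Longrightarrow> is_solution (a j) (b j) l (um j) \<and> um j 0 = 0"
    and "\<And>j. j \<in> {0, 1, 2} \<Longrightarrow> is_solution (a j) (b j) l (up j) \<and> up j (int N) = 0"
    and "positive_semidefinite (jacobi_mat N (a 1) (b 1) - jacobi_mat N (a 2) (b 2))"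
  shows "nodes_cc (a 0) (a 2) (up 0) (um 2) 0 (int N)
      \<ge> nodes_cc (a 0) (a 1) (up 0) (um 1) 0 (int N)
    \<and> nodes_cc (a 0) (a 2) (um 0) (up 2) 0 (int N)
      \<ge> nodes_cc (a 0) (a 1) (um 0) (up 1) 0 (int N)
    \<and> nodes_oc (a 0) (a 2) (up 0) (um 2) 0 (int N)
      \<ge> nodes_oc (a 0) (a 1) (up 0) (um 1) 0 (int N)
    \<and> nodes_oc (a 0) (a 2) (um 0) (up 2) 0 (int N)
      \<ge> nodes_oc (a 0) (a 1) (um 0) (up 1) 0 (int N)
    \<and> nodes_co (a 0) (a 2) (up 0) (um 2) 0 (int N)
      \<ge> nodes_co (a 0) (a 1) (up 0) (um 1) 0 (int N)
    \<and> nodes_co (a 0) (a 2) (um 0) (up 2) 0 (int N)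
      \<ge> nodes_co (a 0) (a 1) (um 0) (up 1) 0 (int N)
    \<and> nodes_oo (a 0) (a 2) (up 0) (um 2) 0 (int N)
      \<ge> nodes_oo (a 0) (a 1) (up 0) (um 1) 0 (int N)
    \<and> nodes_oo (a 0) (a 2) (um 0) (up 2) 0 (int N)
      \<ge> nodes_oo (a 0) (a 1) (um 0) (up 1) 0 (int N)"
proof -
  have neg: "\<And>n. a 0 n < 0" "\<And>n. a 1 n < 0" "\<And>n. a 2 n < 0"
    using assms(2) by simp_all
  have minus: "is_solution (a j) (b j) l (um j)" "um j 0 = 0"
    and plus: "is_solution (a j) (b j) l (up j)" "up j (int N) = 0"
    if "j \<in> {0, 1, 2}" for j
    using that assms(3,4) by blast+
  have N: "N \<ge> 1" using assms(1) by simp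
  have psd: "tridiag_nonneg N (\<lambda>k. a 1 k - a 2 k) (\<lambda>k. b 1 k - b 2 k)"
    using jacobi_diff_tridiag_nonneg[OF N assms(5)] .
  have nz: "um j 1 \<noteq> 0" "up j (int N + 1) \<noteq> 0" if "j \<in> {0, 1, 2}" for j
    using solution_consecutive[OF assms(2)[OF that] minus(1)[OF that], of 0] minus(2)[OF that]
      solution_consecutive[OF assms(2)[OF that] plus(1)[OF that], of "int N"] plus(2)[OF that]
    by simp_all
  \<comment> \<open>The boundary terms of \<open>riccati_below\<close> are fixed by the zeros of
    \<open>um j\<close> at \<open>0\<close> and \<open>up 0\<close> at \<open>N\<close>. Only the
    crossings of \<open>um j\<close> and \<open>eps\<close> at \<open>N\<close> depend on
    \<open>j\<close>.\<close>
  have left: "nodes_cc (a 0) (a j) (up 0) (um j) 0 (int N)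
        = crossings N (um j) - crossings N (up 0) - of_bool (up 0 0 \<noteq> 0)"
      "eps (a 0) (a j) (up 0) (um j) 0 = of_bool (up 0 0 = 0)"
      "eps (a 0) (a j) (up 0) (um j) (int N) = of_bool (um j (int N) = 0)"
    if j: "j \<in> {1, 2}" for j
  proof -
    have j': "j \<in> {0, 1, 2}" using j by blast
    have "a j 0 \<noteq> 0" "a 0 (int N) \<noteq> 0"
      using assms(2)[OF j', of 0] neg(1)[of "int N"] by simp_all
    then show "nodes_cc (a 0) (a j) (up 0) (um j) 0 (int N)
        = crossings N (um j) - crossings N (up 0) - of_bool (up 0 0 \<noteq> 0)"
      "eps (a 0) (a j) (up 0) (um j) 0 = of_bool (up 0 0 = 0)"
      "eps (a 0) (a j) (up 0) (um j) (int N) = of_bool (um j (int N) = 0)"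
      using nodes_cc_crossings[OF neg(1) assms(2)[OF j'] plus(1)[of 0] minus(1)[OF j'], of N]
        plus(2)[of 0] minus(2)[OF j'] nz(1)[OF j'] nz(2)[of 0]
      by (simp_all add: riccati_below_def eps_def wronskian_def)
  qed
  \<comment> \<open>Here the endpoint roles are exchanged: \<open>eps\<close> at \<open>0\<close>
    depends on \<open>j\<close>, and \<open>eps\<close> at \<open>N\<close> does not.\<close>
  have right: "nodes_cc (a 0) (a j) (um 0) (up j) 0 (int N)
        = crossings N (up j) - crossings N (um 0) + of_bool (um 0 (int N) \<noteq> 0)"
      "eps (a 0) (a j) (um 0) (up j) 0 = of_bool (up j 0 = 0)"
      "eps (a 0) (a j) (um 0) (up j) (int N) = of_bool (um 0 (int N) = 0)"
    if j: "j \<in> {1, 2}" for j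
  proof -
    have j': "j \<in> {0, 1, 2}" using j by blast
    have "a 0 0 \<noteq> 0" "a j (int N) \<noteq> 0"
      using assms(2)[OF j', of "int N"] neg(1)[of 0] by simp_all
    then show "nodes_cc (a 0) (a j) (um 0) (up j) 0 (int N)
        = crossings N (up j) - crossings N (um 0) + of_bool (um 0 (int N) \<noteq> 0)"
      "eps (a 0) (a j) (um 0) (up j) 0 = of_bool (up j 0 = 0)"
      "eps (a 0) (a j) (um 0) (up j) (int N) = of_bool (um 0 (int N) = 0)"
      using nodes_cc_crossings[OF neg(1) assms(2)[OF j'] minus(1)[of 0] plus(1)[OF j'], of N]
        minus(2)[of 0] plus(2)[OF j'] nz(2)[OF j'] nz(1)[of 0]
      by (simp_all add: riccati_below_def eps_def wronskian_def)
  qed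
  \<comment> \<open>The endpoint-corrected bound serves the counts open at \<open>N\<close> for
    \<open>um\<close>, and those open at \<open>0\<close> for \<open>up\<close>; the plain bound
    serves the others.\<close>
  have "crossings N (um 1) \<le> crossings N (um 2)"
    "crossings N (um 1) + of_bool (um 1 (int N) = 0) \<le> crossings N (um 2) + of_bool (um 2 (int N) = 0)"
    using crossings_compare[OF neg(2,3) minus(1) minus(1) minus(2) minus(2) psd N] by simp_all
  moreover have "crossings N (up 1) \<le> crossings N (up 2)"
    "crossings N (up 1) - of_bool (up 1 0 = 0) \<le> crossings N (up 2) - of_bool (up 2 0 = 0)"
    using crossings_compare_reflect[OF neg(2,3) plus(1) plus(1) plus(2) plus(2) psd N] by simp_all
  ultimately show ?thesis
    using left[of 1] left[of 2] right[of 1] right[of 2]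
    unfolding nodes_oc_def nodes_co_def nodes_oo_def by simp
qed

end
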